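(* Let $X\neq\emptyset$ be a heap, $Y$ be a subheap of $X$, and $\omega$ a congruence on $X$. The following conditions are equivalent: (a) $Y$ is a set of representatives of the equivalence classes of $X$ modulo $\omega$, that is, $Y\cap[x]_\omega$ is a singleton for every $x\in X$. (b) There exists an idempotent heap endomorphism of $X$ whose image is $Y$ and whose kernel is $\omega$. (c) For every $e\in Y$, there exists an idempotent group endomorphism of the group $(X,b_e)$ whose image is the subgroup $Y$ of $(X,b_e)$ and whose kernel is the normal subgroup $[e]_\omega$ of $(X,b_e)$. (d) There exist an element $e\in Y$ and an idempotent group endomorphism of the group $(X,b_e)$ whose image is the subgroup $Y$ of $(X,b_e)$ and whose kernel is the normal subgroup $[e]_\omega$ of $(X,b_e)$. (e) For every $e\in Y$, the group $(X,b_e)$ is the semidirect product of its subgroup $Y$ and its normal subgroup $[e]_\omega$. (f) There exists an element $e\in Y$ such that the group $(X,b_e)$ is the semidirect product of its subgroup $Y$ and its normal subgroup $[e]_\omega$. (g) For every $a\in X$ and every $c\in Y$ there exist a unique element $b\in X$ and a unique element $d\in Y$ such that $a=p(b,c,d)$ and $b\,\omega\,c$. (h) For every $a\in X$ and every $c\in Y$ there exist a unique element $b\in X$ and a unique element $d\in Y$ such that $a=p(d,c,b)$ and $b\,\omega\,c$. (i) The mapping $g\colon Y\to X/\omega$, defined by $g(y)=[y]_\omega$ for every $y\in Y$, is a heap isomorphism. (l) There exists a heap endomorphism of $X$ whose kernel is $\omega$ and whose restriction to $Y$ is the inclusion of $Y$ in $X$.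
   Context: A heap is a set $X$ with a ternary operation, written $[x,y,z]$ or $p(x,y,z)$, such that $[[x,y,z],w,u]=[x,y,[z,w,u]]$, $[x,x,y]=y$ and $[x,y,y]=x$ for all $x,y,z,w,u\in X$. Heap morphisms are the maps preserving the ternary operation; a subheap is a subset closed under it (the empty subset is a subheap); a congruence is an equivalence relation compatible with it. $[x]_\omega$ denotes the equivalence class of $x$ modulo $\omega$. The kernel of a heap morphism $f$ is the congruence $\{(x,x')\mid f(x)=f(x')\}$. For $e\in X$, $b_e(x,z)=[x,e,z]$; $(X,b_e)$ is a group with identity $e$. If $e\in Y$, then $Y$ is a subgroup of $(X,b_e)$ and $[e]_\omega$ is a normal subgroup of $(X,b_e)$. A group $G$ is the (inner) semidirect product of a subgroup $H$ and a normal subgroup $N$ if $G=NH$ and $N\cap H$ is trivial.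
   Formalization: Y is assumed nonempty (for empty Y, (c), (e), (g), (h) hold vacuously but (a) fails), and (l) also requires the endomorphism to map X into Y (else X=Z/2, Y={0}, ω equality, f=id satisfies (l) but not (a)). *)

theory Defs
  imports "HOL-Algebra.Coset"
begin

locale heap =
  fixes X :: "'a set" and p :: "'a \<Rightarrow> 'a \<Rightarrow> 'a \<Rightarrow> 'a"
  assumes closed: "\<lbrakk>x \<in> X; y \<in> X; z \<in> X\<rbrakk> \<Longrightarrow> p x y z \<in> X"
    and assoc: "\<lbrakk>x \<in> X; y \<in> X; z \<in> X; w \<in> X; u \<in> X\<rbrakk> \<Longrightarrow> p (p x y z) w u = p x y (p z w u)"
    and left_cancel: "\<lbrakk>x \<in> X; y \<in> X\<rbrakk> \<Longrightarrow> p x x y = y"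
    and right_cancel: "\<lbrakk>x \<in> X; y \<in> X\<rbrakk> \<Longrightarrow> p x y y = x"

definition subheap :: "'a set \<Rightarrow> 'a set \<Rightarrow> ('a \<Rightarrow> 'a \<Rightarrow> 'a \<Rightarrow> 'a) \<Rightarrow> bool" where
  "subheap Y X p \<longleftrightarrow> Y \<subseteq> X \<and> (\<forall>x\<in>Y. \<forall>y\<in>Y. \<forall>z\<in>Y. p x y z \<in> Y)"

definition heap_congruence :: "'a set \<Rightarrow> ('a \<Rightarrow> 'a \<Rightarrow> 'a \<Rightarrow> 'a) \<Rightarrow> ('a \<times> 'a) set \<Rightarrow> bool" where
  "heap_congruence X p \<omega> \<longleftrightarrow> equiv X \<omega> \<and>
     (\<forall>x x' y y' z z'. (x, x') \<in> \<omega> \<longrightarrow> (y, y') \<in> \<omega> \<longrightarrow> (z, z') \<in> \<omega> \<longrightarrow>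
        (p x y z, p x' y' z') \<in> \<omega>)"

definition heap_hom ::
  "'a set \<Rightarrow> ('a \<Rightarrow> 'a \<Rightarrow> 'a \<Rightarrow> 'a) \<Rightarrow> 'b set \<Rightarrow> ('b \<Rightarrow> 'b \<Rightarrow> 'b \<Rightarrow> 'b) \<Rightarrow> ('a \<Rightarrow> 'b) set" where
  "heap_hom X p X' p' =
     {f. f \<in> X \<rightarrow> X' \<and> (\<forall>x\<in>X. \<forall>y\<in>X. \<forall>z\<in>X. f (p x y z) = p' (f x) (f y) (f z))}"

definition heap_iso ::
  "'a set \<Rightarrow> ('a \<Rightarrow> 'a \<Rightarrow> 'a \<Rightarrow> 'a) \<Rightarrow> 'b set \<Rightarrow> ('b \<Rightarrow> 'b \<Rightarrow> 'b \<Rightarrow> 'b) \<Rightarrow> ('a \<Rightarrow> 'b) set" where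
  "heap_iso X p X' p' = {f. f \<in> heap_hom X p X' p' \<and> bij_betw f X X'}"

definition heap_kernel :: "'a set \<Rightarrow> ('a \<Rightarrow> 'b) \<Rightarrow> ('a \<times> 'a) set" where
  "heap_kernel X f = {(x, x'). x \<in> X \<and> x' \<in> X \<and> f x = f x'}"

definition idempotent_on :: "'a set \<Rightarrow> ('a \<Rightarrow> 'a) \<Rightarrow> bool" where
  "idempotent_on X f \<longleftrightarrow> (\<forall>x\<in>X. f (f x) = f x)"

text \<open>The operation of the quotient heap, written without choosing representatives;
  the next lemma recovers the usual formula.\<close>

definition quot_op ::
  "('a \<Rightarrow> 'a \<Rightarrow> 'a \<Rightarrow> 'a) \<Rightarrow> ('a \<times> 'a) set \<Rightarrow> 'a set \<Rightarrow> 'a set \<Rightarrow> 'a set \<Rightarrow> 'a set" where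
  "quot_op p \<omega> A B C = (\<Union>a\<in>A. \<Union>b\<in>B. \<Union>c\<in>C. \<omega> `` {p a b c})"

lemma quot_op_class:
  assumes "heap_congruence X p \<omega>" and "x \<in> X" "y \<in> X" "z \<in> X"
  shows "quot_op p \<omega> (\<omega> `` {x}) (\<omega> `` {y}) (\<omega> `` {z}) = \<omega> `` {p x y z}"
proof -
  have eq: "equiv X \<omega>" using assms(1) by (simp add: heap_congruence_def)
  have cls: "\<omega> `` {p a b c} = \<omega> `` {p x y z}"
    if "(x, a) \<in> \<omega>" "(y, b) \<in> \<omega>" "(z, c) \<in> \<omega>" for a b c
    using that assms(1) equiv_class_eq[OF eq, of "p x y z" "p a b c"]
    by (simp add: heap_congruence_def)
  have "x \<in> \<omega> `` {x}" "y \<in> \<omega> `` {y}" "z \<in> \<omega> `` {z}"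
    using assms(2-4) equiv_class_self[OF eq] by blast+
  with cls show ?thesis
    unfolding quot_op_def by blast
qed

text \<open>The group \<open>(X, b\<^sub>e)\<close>.\<close>

definition heap_group :: "'a set \<Rightarrow> ('a \<Rightarrow> 'a \<Rightarrow> 'a \<Rightarrow> 'a) \<Rightarrow> 'a \<Rightarrow> 'a monoid" where
  "heap_group X p e = \<lparr>carrier = X, monoid.mult = (\<lambda>x z. p x e z), one = e\<rparr>"

lemma (in heap) group_heap_group:
  assumes "e \<in> X"
  shows "group (heap_group X p e)"
proof (rule groupI)
  fix x assume "x \<in> carrier (heap_group X p e)"
  then have x: "x \<in> X" by (simp add: heap_group_def)
  have "p (p e x e) e x = e"
    using x assms by (simp add: assoc closed left_cancel right_cancel)
  then show "\<exists>y\<in>carrier (heap_group X p e).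
      y \<otimes>\<^bsub>heap_group X p e\<^esub> x = \<one>\<^bsub>heap_group X p e\<^esub>"
    using x assms by (auto simp: heap_group_def intro!: bexI[of _ "p e x e"] closed)
qed (use assms in \<open>auto simp: heap_group_def closed assoc left_cancel\<close>)

definition inner_semidirect :: "('a, 'b) monoid_scheme \<Rightarrow> 'a set \<Rightarrow> 'a set \<Rightarrow> bool" where
  "inner_semidirect G H N \<longleftrightarrow>
     subgroup H G \<and> N \<lhd> G \<and> carrier G = N <#>\<^bsub>G\<^esub> H \<and> N \<inter> H = {\<one>\<^bsub>G\<^esub>}"

definition all_equivalent :: "bool list \<Rightarrow> bool" where
  "all_equivalent Ps \<longleftrightarrow> (\<forall>P\<in>set Ps. \<forall>Q\<in>set Ps. P \<longleftrightarrow> Q)"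

end

(* For e in Y and x, x' in X, the pair (x, x') lies in \<omega> iff [x, x', e] lies in the class
   of e, so \<omega> is determined by the normal subgroup [e]_\<omega> of the group (X, b_e).  Each condition
   is shown to be equivalent to (a): a transversal Y gives the retraction of X onto Y that
   sends x to its representative, and solving a = [b, c, d] with b \<omega> c amounts to choosing the
   representative d of a, with b = [a, d, c].  Condition (h) is (g) for the opposite heap. *)

theory Submission
  imports Defs
begin

section \<open>Opposite heaps, and passing from group morphisms to heap morphisms\<close>

lemma (in heap) heap_opposite: "heap X (\<lambda>x y z. p z y x)"
  \<comment> \<open>Read backwards, associativity is itself and the two cancellation laws trade
    places.\<close>
  by unfold_locales (simp_all add: closed assoc left_cancel right_cancel)

text \<open>The group determines the heap: \<open>p x y e\<close> is the quotient of
  \<open>x\<close> by \<open>y\<close> in the group at \<open>e\<close>, and multiplying it by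
  \<open>z\<close> gives \<open>p x y z\<close>.\<close>

lemma (in heap) hom_heap_group_imp_heap_hom:
  assumes e: "e \<in> X" and f: "f \<in> hom (heap_group X p e) (heap_group X p e)"
  shows "f \<in> heap_hom X p X p"
proof -
  have fX: "f x \<in> X" if "x \<in> X" for x
    using f that by (auto simp: hom_def heap_group_def)
  have fm: "f (p x e z) = p (f x) e (f z)" if "x \<in> X" "z \<in> X" for x z
    using f that by (auto simp: hom_def heap_group_def)
  have "f (p x y z) = p (f x) (f y) (f z)" if x: "x \<in> X" and y: "y \<in> X" and z: "z \<in> X" for x y z
  proof -
    have "p (p x y e) e y = x"
      using x y e by (simp add: assoc left_cancel right_cancel)
    then have "f x = p (f (p x y e)) e (f y)"
      using fm[of "p x y e" y] x y e by (simp add: closed)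
    \<comment> \<open>Cancelling \<open>f y\<close> on the right shows that \<open>f\<close>
      preserves quotients.\<close>
    then have *: "p (f x) (f y) e = f (p x y e)"
      using x y e by (simp add: assoc closed fX right_cancel left_cancel)
    have "f (p x y z) = f (p (p x y e) e z)"
      using x y z e by (simp add: assoc left_cancel)
    also have "\<dots> = p (p (f x) (f y) e) e (f z)"
      using x y z e by (simp add: fm closed *)
    also have "\<dots> = p (f x) (f y) (f z)"
      using x y z e by (simp add: assoc closed fX left_cancel)
    finally show ?thesis .
  qed
  then show ?thesis
    by (auto simp: heap_hom_def fX)
qed

section \<open>A subheap and a congruence on a fixed heap\<close>

locale subheap_congruence = heap X p
  for X :: "'a set" and p :: "'a \<Rightarrow> 'a \<Rightarrow> 'a \<Rightarrow> 'a" +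
  fixes Y :: "'a set" and \<omega> :: "('a \<times> 'a) set"
  assumes Y: "subheap Y X p" and cong: "heap_congruence X p \<omega>"
begin

lemma equiv: "equiv X \<omega>"
  using cong by (simp add: heap_congruence_def)

lemma refl_\<omega>: "x \<in> X \<Longrightarrow> (x, x) \<in> \<omega>"
  using equiv by (meson equivE refl_onD)

lemma sym_\<omega>: "(x, y) \<in> \<omega> \<Longrightarrow> (y, x) \<in> \<omega>"
  using equiv by (meson equivE symD)

lemma trans_\<omega>: "(x, y) \<in> \<omega> \<Longrightarrow> (y, z) \<in> \<omega> \<Longrightarrow> (x, z) \<in> \<omega>"
  using equiv by (meson equivE transD)

lemma \<omega>_in: "(x, y) \<in> \<omega> \<Longrightarrow> x \<in> X" "(x, y) \<in> \<omega> \<Longrightarrow> y \<in> X"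
  using equiv by (auto simp: equiv_def dest: subsetD)

lemma p_\<omega>: "(x, x') \<in> \<omega> \<Longrightarrow> (y, y') \<in> \<omega> \<Longrightarrow> (z, z') \<in> \<omega> \<Longrightarrow> (p x y z, p x' y' z') \<in> \<omega>"
  using cong by (simp add: heap_congruence_def)

lemma Y_in: "y \<in> Y \<Longrightarrow> y \<in> X"
  using Y by (auto simp: subheap_def)

lemma Y_closed: "\<lbrakk>x \<in> Y; y \<in> Y; z \<in> Y\<rbrakk> \<Longrightarrow> p x y z \<in> Y"
  using Y by (auto simp: subheap_def)

text \<open>The translation sending \<open>u\<close> to \<open>p u x' e\<close> takes
  \<open>x'\<close> to \<open>e\<close>; it respects \<open>\<omega>\<close>, and so does its
  inverse, sending \<open>u\<close> to \<open>p u e x'\<close>. Later uses vary the base point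
  \<open>e\<close>.\<close>

lemma \<omega>_iff:
  assumes "x \<in> X" "x' \<in> X" "e \<in> X"
  shows "(p x x' e, e) \<in> \<omega> \<longleftrightarrow> (x, x') \<in> \<omega>"
proof
  assume "(x, x') \<in> \<omega>"
  then show "(p x x' e, e) \<in> \<omega>"
    using p_\<omega>[of x x' x' x' e e] assms by (simp add: refl_\<omega> left_cancel)
next
  assume "(p x x' e, e) \<in> \<omega>"
  then have "(p (p x x' e) e x', p e e x') \<in> \<omega>"
    using assms by (intro p_\<omega>) (simp_all add: refl_\<omega>)
  then show "(x, x') \<in> \<omega>"
    using assms by (simp add: assoc left_cancel right_cancel)
qed

text \<open>Makes every result of this locale available with the arguments of \<open>p\<close>
  reversed, which turns (g) into (h).\<close>

lemma opposite: "subheap_congruence X (\<lambda>x y z. p z y x) Y \<omega>"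
  by (intro subheap_congruence.intro heap_opposite subheap_congruence_axioms.intro)
     (use equiv p_\<omega> Y_in Y_closed in \<open>auto simp: subheap_def heap_congruence_def\<close>)

section \<open>Transversals and retractions\<close>

definition transversal :: bool where
  "transversal \<longleftrightarrow> (\<forall>x\<in>X. \<exists>!y. y \<in> Y \<and> (x, y) \<in> \<omega>)"

lemma is_singleton_iff_transversal:
  "(\<forall>x\<in>X. is_singleton (Y \<inter> \<omega> `` {x})) \<longleftrightarrow> transversal"
proof -
  have "is_singleton A \<longleftrightarrow> (\<exists>!y. y \<in> A)" for A :: "'a set"
    unfolding is_singleton_def by blast
  then show ?thesis
    by (simp add: transversal_def)
qed

text \<open>This is condition (l), with the image required to lie in \<open>Y\<close>. That clause
  matters: if \<open>\<omega>\<close> is equality and \<open>Y\<close> is a proper subheap, the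
  identity fixes \<open>Y\<close> and has kernel \<open>\<omega>\<close>, yet \<open>Y\<close>
  misses some classes.\<close>

definition retraction :: "('a \<Rightarrow> 'a) \<Rightarrow> bool" where
  "retraction f \<longleftrightarrow>
     f \<in> heap_hom X p X p \<and> f ` X \<subseteq> Y \<and> heap_kernel X f = \<omega> \<and> (\<forall>y\<in>Y. f y = y)"

lemma retraction_kernel: "retraction f \<Longrightarrow> (x, y) \<in> \<omega> \<longleftrightarrow> x \<in> X \<and> y \<in> X \<and> f x = f y"
  by (auto simp: retraction_def heap_kernel_def)

lemma retraction_iff_transversal: "(\<exists>f. retraction f) \<longleftrightarrow> transversal"
proof
  assume "\<exists>f. retraction f"
  then obtain f where f: "retraction f" by blast
  have fY: "f x \<in> Y" if "x \<in> X" for x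
    using f that by (auto simp: retraction_def)
  have id: "f y = y" if "y \<in> Y" for y
    using f that by (auto simp: retraction_def)
  show transversal
    unfolding transversal_def
  proof (intro ballI ex1I)
    \<comment> \<open>The representative of \<open>x\<close> is \<open>f x\<close>: it lies in
      \<open>Y\<close>, so \<open>f\<close> fixes it, and hence \<open>x\<close> and
      \<open>f x\<close> have the same image.\<close>
    fix x assume "x \<in> X"
    then show "f x \<in> Y \<and> (x, f x) \<in> \<omega>"
      by (simp add: retraction_kernel[OF f] fY id Y_in)
  qed (auto simp: retraction_kernel[OF f] id)
next
  assume t: transversal
  define f where "f x = (THE y. y \<in> Y \<and> (x, y) \<in> \<omega>)" for x
  have f: "f x \<in> Y" "(x, f x) \<in> \<omega>" if "x \<in> X" for x
    using theI'[of "\<lambda>y. y \<in> Y \<and> (x, y) \<in> \<omega>"] t that unfolding transversal_def f_def by auto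
  \<comment> \<open>Uniqueness of representatives: a value of \<open>f\<close> is found by
    exhibiting any element of \<open>Y\<close> in the right class.\<close>
  have fI: "f x = y" if "y \<in> Y" "(x, y) \<in> \<omega>" for x y
    using t that f[OF \<omega>_in(1)[OF that(2)]] \<omega>_in(1)[OF that(2)] unfolding transversal_def by blast
  have "f x = f y \<longleftrightarrow> (x, y) \<in> \<omega>" if "x \<in> X" "y \<in> X" for x y
    using that f fI by (metis sym_\<omega> trans_\<omega>)
  then have "heap_kernel X f = \<omega>"
    by (auto simp: heap_kernel_def \<omega>_in)
  moreover have "f (p x y z) = p (f x) (f y) (f z)" if "x \<in> X" "y \<in> X" "z \<in> X" for x y z
    \<comment> \<open>The element \<open>p (f x) (f y) (f z)\<close> is in \<open>Y\<close> because
      \<open>Y\<close> is a subheap, and in the class of \<open>p x y z\<close> because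
      \<open>\<omega>\<close> is a congruence.\<close>
    using that f by (intro fI Y_closed p_\<omega>) auto
  ultimately have "retraction f"
    using f fI by (auto simp: retraction_def heap_hom_def Y_in refl_\<omega>)
  then show "\<exists>f. retraction f" by blast
qed

text \<open>An idempotent map fixes exactly the points of its image, so (b) and (l) describe the
  same maps.\<close>

lemma retraction_iff_idempotent:
  "retraction f \<longleftrightarrow>
     f \<in> heap_hom X p X p \<and> idempotent_on X f \<and> f ` X = Y \<and> heap_kernel X f = \<omega>"
proof -
  have "f ` X \<subseteq> Y \<and> (\<forall>y\<in>Y. f y = y) \<longleftrightarrow> idempotent_on X f \<and> f ` X = Y"
  proof
    assume *: "f ` X \<subseteq> Y \<and> (\<forall>y\<in>Y. f y = y)"
    then have "y \<in> f ` X" if "y \<in> Y" for y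
      using that by (intro image_eqI[of _ _ y]) (simp_all add: Y_in)
    with * show "idempotent_on X f \<and> f ` X = Y"
      by (auto simp: idempotent_on_def)
  qed (auto simp: idempotent_on_def)
  then show ?thesis
    by (auto simp: retraction_def)
qed

text \<open>A heap morphism fixing \<open>e\<close> is a group morphism at \<open>e\<close>, and
  conversely the group kernel recovers the whole heap kernel. Since \<open>retraction f\<close> does
  not mention \<open>e\<close>, the choice of \<open>e\<close> in (c) and (d) is immaterial.\<close>

lemma retraction_iff_hom:
  assumes e: "e \<in> Y"
  shows "retraction f \<longleftrightarrow>
    f \<in> hom (heap_group X p e) (heap_group X p e) \<and> idempotent_on X f \<and>
    f ` X = Y \<and> kernel (heap_group X p e) (heap_group X p e) f = \<omega> `` {e}"
    (is "_ \<longleftrightarrow> f \<in> hom ?G ?G \<and> _ \<and> _ \<and> ?K = _")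
proof
  assume r: "retraction f"
  then have "f e = e" "f \<in> heap_hom X p X p"
    using e by (auto simp: retraction_def)
  then have "f \<in> hom ?G ?G"
    using e by (auto simp: heap_hom_def hom_def heap_group_def Y_in)
  moreover have "?K = \<omega> `` {e}"
    using \<open>f e = e\<close> e by (auto simp: kernel_def heap_group_def retraction_kernel[OF r] Y_in)
  ultimately show "f \<in> hom ?G ?G \<and> idempotent_on X f \<and> f ` X = Y \<and> ?K = \<omega> `` {e}"
    using r by (simp add: retraction_iff_idempotent)
next
  assume *: "f \<in> hom ?G ?G \<and> idempotent_on X f \<and> f ` X = Y \<and> ?K = \<omega> `` {e}"
  have eX: "e \<in> X" using e by (rule Y_in)
  have hom: "f \<in> heap_hom X p X p"
    using * hom_heap_group_imp_heap_hom[OF eX] by blast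
  then have fX: "f x \<in> X" if "x \<in> X" for x
    using that by (auto simp: heap_hom_def)
  \<comment> \<open>As a member of \<open>Y\<close>, \<open>e\<close> is in the image of
    \<open>f\<close>, which idempotence fixes pointwise.\<close>
  have fe: "f e = e"
    using * e by (auto simp: idempotent_on_def)
  have ker: "(x, e) \<in> \<omega> \<longleftrightarrow> f x = e" if "x \<in> X" for x
  proof -
    have "x \<in> ?K \<longleftrightarrow> f x = e"
      using that by (simp add: kernel_def heap_group_def)
    then show ?thesis
      using * sym_\<omega> by auto
  qed
  have "f x = f y \<longleftrightarrow> (x, y) \<in> \<omega>" if x: "x \<in> X" and y: "y \<in> X" for x y
  proof -
    \<comment> \<open>Both relations are tested on the quotient \<open>p x y e\<close>, which
      reduces them to the class of \<open>e\<close>.\<close>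
    have "(x, y) \<in> \<omega> \<longleftrightarrow> f (p x y e) = e"
      using x y eX by (simp add: ker closed flip: \<omega>_iff[of x y e])
    also have "\<dots> \<longleftrightarrow> p (f x) (f y) e = e"
      using hom x y eX by (simp add: heap_hom_def fe)
    also have "\<dots> \<longleftrightarrow> f x = f y"
    proof
      assume "p (f x) (f y) e = e"
      then have "p (p (f x) (f y) e) e (f y) = f y"
        using x y eX by (simp add: fX left_cancel)
      then show "f x = f y"
        using x y eX by (simp add: fX assoc left_cancel right_cancel)
    qed (use x y eX in \<open>simp add: fX left_cancel\<close>)
    finally show ?thesis by blast
  qed
  then have "heap_kernel X f = \<omega>"
    by (auto simp: heap_kernel_def \<omega>_in)
  with * hom show "retraction f"
    by (simp add: retraction_iff_idempotent)
qed

section \<open>Factorizations and semidirect products\<close>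

lemma factorization_iff:
  assumes a: "a \<in> X" and c: "c \<in> Y"
  shows "b \<in> X \<and> d \<in> Y \<and> a = p b c d \<and> (b, c) \<in> \<omega> \<longleftrightarrow>
    d \<in> Y \<and> (a, d) \<in> \<omega> \<and> b = p a d c"
proof
  assume *: "b \<in> X \<and> d \<in> Y \<and> a = p b c d \<and> (b, c) \<in> \<omega>"
  \<comment> \<open>Here \<open>d\<close> is the base point in \<open>\<omega>_iff\<close>; the
    converse below takes \<open>c\<close>.\<close>
  then have "(p b c d, d) \<in> \<omega>"
    using c by (simp add: \<omega>_iff Y_in)
  moreover have "b = p (p b c d) d c"
    using * c by (simp add: assoc Y_in left_cancel right_cancel)
  ultimately show "d \<in> Y \<and> (a, d) \<in> \<omega> \<and> b = p a d c"
    using * by simp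
next
  assume *: "d \<in> Y \<and> (a, d) \<in> \<omega> \<and> b = p a d c"
  then have "(p a d c, c) \<in> \<omega>"
    using a c by (simp add: \<omega>_iff Y_in)
  moreover have "a = p (p a d c) c d"
    using * a c by (simp add: assoc Y_in left_cancel right_cancel)
  ultimately show "b \<in> X \<and> d \<in> Y \<and> a = p b c d \<and> (b, c) \<in> \<omega>"
    using * a c by (simp add: closed Y_in)
qed

text \<open>In a factorization \<open>b\<close> is the function \<open>p a d c\<close> of
  \<open>d\<close>, so unique pairs amount to unique representatives \<open>d\<close>. A nonempty
  \<open>Y\<close> supplies the \<open>c\<close> needed to recover
  \<open>transversal\<close>.\<close>

lemma factorization_iff_transversal:
  assumes "Y \<noteq> {}"
  shows "(\<forall>a\<in>X. \<forall>c\<in>Y. \<exists>!(b, d) \<in> X \<times> Y. a = p b c d \<and> (b, c) \<in> \<omega>) \<longleftrightarrow> transversal"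
proof -
  have "(\<exists>!(b, d) \<in> X \<times> Y. a = p b c d \<and> (b, c) \<in> \<omega>) \<longleftrightarrow> (\<exists>!d. d \<in> Y \<and> (a, d) \<in> \<omega>)"
    if "a \<in> X" "c \<in> Y" for a c
  proof -
    have "(\<exists>!(b, d) \<in> X \<times> Y. a = p b c d \<and> (b, c) \<in> \<omega>) \<longleftrightarrow>
        (\<exists>!(b, d). b \<in> X \<and> d \<in> Y \<and> a = p b c d \<and> (b, c) \<in> \<omega>)"
      by (rule arg_cong[where f = Ex1]) auto
    also have "\<dots> \<longleftrightarrow> (\<exists>!(b, d). d \<in> Y \<and> (a, d) \<in> \<omega> \<and> b = p a d c)"
      by (simp only: factorization_iff[OF that])
    also have "\<dots> \<longleftrightarrow> (\<exists>!d. d \<in> Y \<and> (a, d) \<in> \<omega>)"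
      by (auto simp: Ex1_def)
    finally show ?thesis .
  qed
  then show ?thesis
    using assms by (auto simp: transversal_def)
qed

text \<open>The product decomposition gives existence of representatives and the trivial
  intersection gives uniqueness. Again the right-hand side is independent of
  \<open>e\<close>.\<close>

lemma inner_semidirect_iff_transversal:
  assumes e: "e \<in> Y"
  shows "inner_semidirect (heap_group X p e) Y (\<omega> `` {e}) \<longleftrightarrow> transversal"
    (is "inner_semidirect ?G _ ?N \<longleftrightarrow> _")
proof
  have eX: "e \<in> X" using e by (rule Y_in)
  assume "inner_semidirect ?G Y ?N"
  then have XNY: "X = ?N <#>\<^bsub>?G\<^esub> Y" and N: "?N \<inter> Y = {e}"
    by (auto simp: inner_semidirect_def heap_group_def)
  show transversal
    unfolding transversal_def
  proof (intro ballI ex_ex1I)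
    fix x assume "x \<in> X"
    then have "x \<in> ?N <#>\<^bsub>?G\<^esub> Y"
      using XNY by simp
    then obtain b y where b: "(e, b) \<in> \<omega>" and y: "y \<in> Y" and "x = p b e y"
      by (auto simp: set_mult_def heap_group_def)
    then have "(x, y) \<in> \<omega>"
      using eX \<omega>_iff[of b e y] by (simp add: \<omega>_in Y_in sym_\<omega>)
    with y show "\<exists>y. y \<in> Y \<and> (x, y) \<in> \<omega>" by blast
  next
    fix x y z
    assume "y \<in> Y \<and> (x, y) \<in> \<omega>" "z \<in> Y \<and> (x, z) \<in> \<omega>"
    then have y: "y \<in> Y" and z: "z \<in> Y" and "(y, z) \<in> \<omega>"
      using sym_\<omega> trans_\<omega> by blast+
    \<comment> \<open>The quotient of two representatives of one class lies in both subgroups, so it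
      is \<open>e\<close>.\<close>
    then have "p y z e \<in> ?N \<inter> Y"
      using e by (simp add: Y_closed \<omega>_iff Y_in sym_\<omega>)
    then have "p (p y z e) e z = z"
      using N z eX by (simp add: Y_in left_cancel)
    then show "y = z"
      using y z eX by (simp add: assoc Y_in left_cancel right_cancel)
  qed
next
  have eX: "e \<in> X" using e by (rule Y_in)
  assume t: transversal
  then obtain f where "retraction f"
    using retraction_iff_transversal by blast
  \<comment> \<open>Subgroup and normality come for free: \<open>Y\<close> is the image and
    \<open>?N\<close> the kernel of a group endomorphism.\<close>
  then have f: "f \<in> hom ?G ?G" "f ` X = Y" "kernel ?G ?G f = ?N"
    using retraction_iff_hom[OF e] by blast+
  interpret group_hom ?G ?G f
    using group_heap_group[OF eX] f(1) by (simp add: group_hom_def group_hom_axioms_def)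
  have "subgroup Y ?G"
    using img_is_subgroup f(2) by (simp add: heap_group_def)
  moreover have "?N \<lhd> ?G"
    using normal_kernel f(3) by simp
  moreover have "X = ?N <#>\<^bsub>?G\<^esub> Y"
  proof (intro subset_antisym subsetI)
    fix x assume x: "x \<in> X"
    then obtain d where "d \<in> Y" "(x, d) \<in> \<omega>"
      using t by (auto simp: transversal_def)
    \<comment> \<open>The factorization with \<open>c\<close> equal to \<open>e\<close> is a product
      in the group.\<close>
    then have "d \<in> Y" "x = p (p x d e) e d" "(p x d e, e) \<in> \<omega>"
      using factorization_iff[OF x e, of "p x d e" d] by blast+
    then show "x \<in> ?N <#>\<^bsub>?G\<^esub> Y"
      by (auto simp: set_mult_def heap_group_def intro: sym_\<omega>)
  qed (auto simp: set_mult_def heap_group_def closed eX Y_in \<omega>_in)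
  moreover have "?N \<inter> Y = {e}"
    using t e eX refl_\<omega>[OF eX] unfolding transversal_def by blast
  ultimately show "inner_semidirect ?G Y ?N"
    by (simp add: inner_semidirect_def heap_group_def)
qed

text \<open>The map to classes is always a morphism, so only bijectivity counts: injectivity says at
  most one representative per class, surjectivity at least one.\<close>

lemma heap_iso_iff_transversal:
  "(\<lambda>y. \<omega> `` {y}) \<in> heap_iso Y p (X // \<omega>) (quot_op p \<omega>) \<longleftrightarrow> transversal"
proof -
  have "(\<lambda>y. \<omega> `` {y}) \<in> heap_hom Y p (X // \<omega>) (quot_op p \<omega>)"
    by (auto simp: heap_hom_def quot_op_class[OF cong] Y_in intro: quotientI)
  moreover have "bij_betw (\<lambda>y. \<omega> `` {y}) Y (X // \<omega>) \<longleftrightarrow> transversal"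
  proof -
    have "inj_on (\<lambda>y. \<omega> `` {y}) Y \<longleftrightarrow> (\<forall>y\<in>Y. \<forall>z\<in>Y. (y, z) \<in> \<omega> \<longrightarrow> y = z)"
      by (auto simp: inj_on_def Y_in eq_equiv_class_iff[OF equiv])
    moreover have "(\<lambda>y. \<omega> `` {y}) ` Y = X // \<omega> \<longleftrightarrow> (\<forall>x\<in>X. \<exists>y\<in>Y. (x, y) \<in> \<omega>)"
    proof -
      have "(\<lambda>y. \<omega> `` {y}) ` Y \<subseteq> X // \<omega>"
        by (auto simp: Y_in intro: quotientI)
      then have "(\<lambda>y. \<omega> `` {y}) ` Y = X // \<omega> \<longleftrightarrow> (\<forall>x\<in>X. \<exists>y\<in>Y. \<omega> `` {x} = \<omega> `` {y})"
        \<comment> \<open>The type instantiation unfolds equality of sets of classes only, leaving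
          equations between classes intact.\<close>
        by (auto simp: set_eq_iff[where 'a = "'a set"] image_iff quotient_def subset_iff)
      then show ?thesis
        by (simp add: eq_equiv_class_iff[OF equiv] Y_in)
    qed
    ultimately show ?thesis
      unfolding bij_betw_def transversal_def
      by (safe; metis Y_in sym_\<omega> trans_\<omega> refl_\<omega>)
  qed
  ultimately show ?thesis
    by (simp add: heap_iso_def)
qed

end

theorem proposition5p1:
  fixes X Y :: "'a set" and p :: "'a \<Rightarrow> 'a \<Rightarrow> 'a \<Rightarrow> 'a" and \<omega> :: "('a \<times> 'a) set"
  assumes "heap X p" and "X \<noteq> {}"
    and "subheap Y X p" and "Y \<noteq> {}"
    and "heap_congruence X p \<omega>"
  shows "all_equivalent
    [\<forall>x\<in>X. is_singleton (Y \<inter> \<omega> `` {x}),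
     \<exists>f. f \<in> heap_hom X p X p \<and> idempotent_on X f \<and> f ` X = Y \<and> heap_kernel X f = \<omega>,
     \<forall>e\<in>Y. \<exists>f. f \<in> hom (heap_group X p e) (heap_group X p e) \<and> idempotent_on X f \<and>
       f ` X = Y \<and> kernel (heap_group X p e) (heap_group X p e) f = \<omega> `` {e},
     \<exists>e\<in>Y. \<exists>f. f \<in> hom (heap_group X p e) (heap_group X p e) \<and> idempotent_on X f \<and>
       f ` X = Y \<and> kernel (heap_group X p e) (heap_group X p e) f = \<omega> `` {e},
     \<forall>e\<in>Y. inner_semidirect (heap_group X p e) Y (\<omega> `` {e}),
     \<exists>e\<in>Y. inner_semidirect (heap_group X p e) Y (\<omega> `` {e}),
     \<forall>a\<in>X. \<forall>c\<in>Y. \<exists>!(b, d) \<in> X \<times> Y. a = p b c d \<and> (b, c) \<in> \<omega>,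
     \<forall>a\<in>X. \<forall>c\<in>Y. \<exists>!(b, d) \<in> X \<times> Y. a = p d c b \<and> (b, c) \<in> \<omega>,
     (\<lambda>y. \<omega> `` {y}) \<in> heap_iso Y p (X // \<omega>) (quot_op p \<omega>),
     \<exists>f. f \<in> heap_hom X p X p \<and> f ` X \<subseteq> Y \<and> heap_kernel X f = \<omega> \<and> (\<forall>y\<in>Y. f y = y)]"
proof -
  interpret subheap_congruence X p Y \<omega>
    using assms by (simp add: subheap_congruence_def subheap_congruence_axioms_def)
  interpret op: subheap_congruence X "\<lambda>x y z. p z y x" Y \<omega>
    by (rule opposite)
  show ?thesis
    unfolding is_singleton_iff_transversal factorization_iff_transversal[OF \<open>Y \<noteq> {}\<close>]
      op.factorization_iff_transversal[OF \<open>Y \<noteq> {}\<close>] heap_iso_iff_transversal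
      retraction_def[symmetric] retraction_iff_idempotent[symmetric] retraction_iff_transversal
    using \<open>Y \<noteq> {}\<close>
    \<comment> \<open>Only (c) to (f) still quantify over \<open>e\<close>; their bodies do not
      depend on it, and \<open>Y\<close> is nonempty, so both quantifiers give
      \<open>transversal\<close>.\<close>
    by (auto simp: all_equivalent_def inner_semidirect_iff_transversal
        retraction_iff_transversal simp flip: retraction_iff_hom)
qed

end
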